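(* Let $\mathbb{F}$ be a field of characteristic zero and let $L$ be a finite-dimensional Lie algebra over $\mathbb{F}$ whose lattice of ideals $\mathcal{L}_{\mathrm{id}}(L)$ is finite. Then $\mathcal{L}_{\mathrm{id}}(L)$ is a distributive lattice. Moreover, $\mathcal{L}_{\mathrm{id}}(L)$ is isomorphic to a sublattice of the $n$-cube lattice $Q_n$ for some $n\ge 0$.
   Context: $\mathcal{L}_{\mathrm{id}}(L)$ denotes the set of ideals of $L$ ordered by inclusion; it is a lattice with join $A\vee B=A+B$ and meet $A\wedge B=A\cap B$. A lattice is distributive if $a\wedge(b\vee c)=(a\wedge b)\vee(a\wedge c)$ for all $a,b,c$ (equivalently $a\vee(b\wedge c)=(a\vee b)\wedge(a\vee c)$). $Q_n$ is the lattice of all subsets of $\{1,\dots,n\}$ under union and intersection ($Q_0$ is the lattice of subsets of the empty set). *)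

theory Defs
  imports
    Complex_Main
    "HOL-Library.Set_Algebras"
    "HOL-Algebra.Lattice"
begin

section \<open>Lie algebras and their ideals\<close>

locale lie_algebra = vector_space scale
  for scale :: "'f::field \<Rightarrow> 'a::ab_group_add \<Rightarrow> 'a" +
  fixes bracket :: "'a \<Rightarrow> 'a \<Rightarrow> 'a"
  assumes bracket_linear_left: "Vector_Spaces.linear scale scale (\<lambda>x. bracket x y)"
    and bracket_linear_right: "Vector_Spaces.linear scale scale (\<lambda>y. bracket x y)"
    and bracket_self: "bracket x x = 0"
    and jacobi: "bracket x (bracket y z) + bracket y (bracket z x) + bracket z (bracket x y) = 0"

text \<open>One-sided absorption suffices: the bracket of a Lie algebra is antisymmetric.\<close>

definition lie_ideal ::
  "('f::field \<Rightarrow> 'a::ab_group_add \<Rightarrow> 'a) \<Rightarrow> ('a \<Rightarrow> 'a \<Rightarrow> 'a) \<Rightarrow> 'a set \<Rightarrow> bool" where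
  "lie_ideal scale bracket I \<longleftrightarrow>
     module.subspace scale I \<and> (\<forall>x. \<forall>y\<in>I. bracket x y \<in> I)"

definition ideal_lattice ::
  "('f::field \<Rightarrow> 'a::ab_group_add \<Rightarrow> 'a) \<Rightarrow> ('a \<Rightarrow> 'a \<Rightarrow> 'a) \<Rightarrow> 'a set gorder" where
  "ideal_lattice scale bracket =
     \<lparr>carrier = {I. lie_ideal scale bracket I}, eq = (=), le = (\<subseteq>)\<rparr>"

section \<open>Distributive lattices, sublattices and isomorphisms\<close>

locale distributive_lattice = lattice +
  assumes meet_join_distrib:
    "\<lbrakk>a \<in> carrier L; b \<in> carrier L; c \<in> carrier L\<rbrakk>
     \<Longrightarrow> a \<sqinter> (b \<squnion> c) = (a \<sqinter> b) \<squnion> (a \<sqinter> c)"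

definition sublattice :: "'a set \<Rightarrow> 'a gorder \<Rightarrow> bool" where
  "sublattice S L \<longleftrightarrow> S \<noteq> {} \<and> S \<subseteq> carrier L \<and>
     (\<forall>x\<in>S. \<forall>y\<in>S. x \<squnion>\<^bsub>L\<^esub> y \<in> S \<and> x \<sqinter>\<^bsub>L\<^esub> y \<in> S)"

text \<open>Meant for lattices whose equivalence \<open>eq\<close> is equality.\<close>

definition lattice_isomorphic :: "'a gorder \<Rightarrow> 'b gorder \<Rightarrow> bool" where
  "lattice_isomorphic L M \<longleftrightarrow>
     (\<exists>h. bij_betw h (carrier L) (carrier M) \<and>
          (\<forall>x\<in>carrier L. \<forall>y\<in>carrier L.
             h (x \<squnion>\<^bsub>L\<^esub> y) = h x \<squnion>\<^bsub>M\<^esub> h y \<and> h (x \<sqinter>\<^bsub>L\<^esub> y) = h x \<sqinter>\<^bsub>M\<^esub> h y))"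

definition cube_lattice :: "nat \<Rightarrow> nat set gorder" where
  "cube_lattice n = \<lparr>carrier = Pow {1..n}, eq = (=), le = (\<subseteq>)\<rparr>"

section \<open>The lattice operations are the expected ones\<close>

lemma inclusion_partial_order:
  "partial_order \<lparr>carrier = C, eq = (=), le = (\<subseteq>)\<rparr>"
  by unfold_locales auto

lemma inclusion_lattice:
  fixes C :: "'a set set"
  defines "L \<equiv> \<lparr>carrier = C, eq = (=), le = (\<subseteq>)\<rparr>"
  assumes j: "\<And>A B. A \<in> C \<Longrightarrow> B \<in> C \<Longrightarrow> least L (j A B) (Upper L {A, B})"
    and m: "\<And>A B. A \<in> C \<Longrightarrow> B \<in> C \<Longrightarrow> greatest L (m A B) (Lower L {A, B})"
  shows "lattice L"
    and "\<And>A B. A \<in> C \<Longrightarrow> B \<in> C \<Longrightarrow> A \<squnion>\<^bsub>L\<^esub> B = j A B"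
    and "\<And>A B. A \<in> C \<Longrightarrow> B \<in> C \<Longrightarrow> A \<sqinter>\<^bsub>L\<^esub> B = m A B"
proof -
  interpret partial_order L
    unfolding L_def by (rule inclusion_partial_order)
  have C: "carrier L = C" by (simp add: L_def)
  show lat: "lattice L"
    by unfold_locales (use j m C in metis)+
  show "A \<squnion>\<^bsub>L\<^esub> B = j A B" if "A \<in> C" "B \<in> C" for A B
    unfolding join_def Lattice.sup_def
    by (rule some_equality[where P="\<lambda>x. least L x (Upper L {A, B})"])
       (use j[OF that] least_unique in blast)+
  show "A \<sqinter>\<^bsub>L\<^esub> B = m A B" if "A \<in> C" "B \<in> C" for A B
    unfolding meet_def Lattice.inf_def
    by (rule some_equality[where P="\<lambda>x. greatest L x (Lower L {A, B})"])
       (use m[OF that] greatest_unique in blast)+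
qed

context lie_algebra
begin

lemma lie_ideal_iff: "lie_ideal scale bracket I \<longleftrightarrow> subspace I \<and> (\<forall>x. \<forall>y\<in>I. bracket x y \<in> I)"
  by (simp add: lie_ideal_def)

lemma bracket_add_right: "bracket x (y + z) = bracket x y + bracket x z"
proof -
  interpret r: Vector_Spaces.linear scale scale "\<lambda>y. bracket x y"
    by (rule bracket_linear_right)
  show ?thesis by (rule r.add)
qed

lemma lie_ideal_sum:
  assumes "lie_ideal scale bracket A" "lie_ideal scale bracket B"
  shows "lie_ideal scale bracket (A + B)"
proof -
  have "A + B = {a + b |a b. a \<in> A \<and> b \<in> B}"
    by (auto simp: set_plus_def)
  then have "subspace (A + B)"
    using assms subspace_sums[of A B] by (simp add: lie_ideal_iff)
  moreover have "bracket x y \<in> A + B" if "y \<in> A + B" for x y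
    using that assms by (auto simp: lie_ideal_iff bracket_add_right elim!: set_plus_elim intro!: set_plus_intro)
  ultimately show ?thesis by (simp add: lie_ideal_iff)
qed

lemma lie_ideal_inter:
  "lie_ideal scale bracket A \<Longrightarrow> lie_ideal scale bracket B \<Longrightarrow> lie_ideal scale bracket (A \<inter> B)"
  by (simp add: lie_ideal_iff subspace_inter)

lemma ideal_least:
  assumes A: "lie_ideal scale bracket A" and B: "lie_ideal scale bracket B"
  shows "least (ideal_lattice scale bracket) (A + B) (Upper (ideal_lattice scale bracket) {A, B})"
proof -
  have 0: "0 \<in> A" "0 \<in> B" using A B by (auto simp: lie_ideal_iff subspace_0)
  have "A \<subseteq> A + B" "B \<subseteq> A + B"
    using set_zero_plus2[OF 0(2), of A] set_zero_plus2[OF 0(1), of B] by (auto simp: add.commute)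
  moreover have "A + B \<subseteq> U" if "lie_ideal scale bracket U" "A \<subseteq> U" "B \<subseteq> U" for U
    using that by (auto simp: lie_ideal_iff subspace_add subset_iff elim!: set_plus_elim)
  ultimately show ?thesis
    using lie_ideal_sum[OF A B] A B
    by (simp add: least_def Upper_def ideal_lattice_def)
qed

lemma ideal_greatest:
  assumes A: "lie_ideal scale bracket A" and B: "lie_ideal scale bracket B"
  shows "greatest (ideal_lattice scale bracket) (A \<inter> B) (Lower (ideal_lattice scale bracket) {A, B})"
  using lie_ideal_inter[OF A B] A B
  by (simp add: greatest_def Lower_def ideal_lattice_def)

lemma lattice_ideal_lattice: "lattice (ideal_lattice scale bracket)"
  and join_ideal_lattice:
    "\<lbrakk>lie_ideal scale bracket A; lie_ideal scale bracket B\<rbrakk>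
     \<Longrightarrow> A \<squnion>\<^bsub>ideal_lattice scale bracket\<^esub> B = A + B"
  and meet_ideal_lattice:
    "\<lbrakk>lie_ideal scale bracket A; lie_ideal scale bracket B\<rbrakk>
     \<Longrightarrow> A \<sqinter>\<^bsub>ideal_lattice scale bracket\<^esub> B = A \<inter> B"
  using inclusion_lattice[of "{I. lie_ideal scale bracket I}" "(+)" "(\<inter>)"]
    ideal_least ideal_greatest
  unfolding ideal_lattice_def by auto

end

lemma lattice_cube_lattice: "lattice (cube_lattice n)"
  and join_cube_lattice:
    "\<lbrakk>A \<subseteq> {1..n}; B \<subseteq> {1..n}\<rbrakk> \<Longrightarrow> A \<squnion>\<^bsub>cube_lattice n\<^esub> B = A \<union> B"
  and meet_cube_lattice:
    "\<lbrakk>A \<subseteq> {1..n}; B \<subseteq> {1..n}\<rbrakk> \<Longrightarrow> A \<sqinter>\<^bsub>cube_lattice n\<^esub> B = A \<inter> B"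
proof -
  have j: "least (cube_lattice n) (A \<union> B) (Upper (cube_lattice n) {A, B})"
    and m: "greatest (cube_lattice n) (A \<inter> B) (Lower (cube_lattice n) {A, B})"
    if "A \<in> Pow {1..n}" "B \<in> Pow {1..n}" for A B
    using that
    by (auto simp: least_def Upper_def greatest_def Lower_def cube_lattice_def)
  note * = inclusion_lattice[of "Pow {1..n}" "(\<union>)" "(\<inter>)", folded cube_lattice_def, OF j m]
  show "lattice (cube_lattice n)" using * by blast
  show "A \<squnion>\<^bsub>cube_lattice n\<^esub> B = A \<union> B" if "A \<subseteq> {1..n}" "B \<subseteq> {1..n}" using * that by blast
  show "A \<sqinter>\<^bsub>cube_lattice n\<^esub> B = A \<inter> B" if "A \<subseteq> {1..n}" "B \<subseteq> {1..n}" using * that by blast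
qed

end

theory Submission
  imports Defs
begin

text \<open>If \<open>x = b + c\<close> lies in \<open>A \<inter> (B + C)\<close>, rescaling the \<open>C\<close>-component by \<open>t\<close> deforms
  \<open>{b + c | b \<in> B, c \<in> C, b + c \<in> A}\<close> into a family of ideals indexed by the infinite ground field.
  When two members of this family coincide, comparing components gives
  \<open>c \<in> A \<inter> C + B \<inter> C\<close>, whence \<open>x \<in> A \<inter> B + A \<inter> C\<close>.
  The embedding into a cube is Birkhoff's: an element goes to the set of
  join-irreducible elements below it.\<close>

section \<open>Deformed sums of ideals and distributivity\<close>

context lie_algebra
begin

definition twisted_sum :: "'a set \<Rightarrow> 'a set \<Rightarrow> 'a set \<Rightarrow> 'f \<Rightarrow> 'a set" where
  "twisted_sum A B C t = {b + scale t c | b c. b \<in> B \<and> c \<in> C \<and> b + c \<in> A}"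

lemma bracket_scale_right: "bracket x (scale t y) = scale t (bracket x y)"
proof -
  interpret r: Vector_Spaces.linear scale scale "\<lambda>y. bracket x y"
    by (rule bracket_linear_right)
  show ?thesis by (rule r.scale)
qed

text \<open>The pairs \<open>(b, c)\<close> in \<open>B \<times> C\<close> with
  \<open>b + c \<in> A\<close> form a subspace stable under the componentwise action of
  \<open>bracket x\<close>. The map sending \<open>(b, c)\<close> to \<open>b + scale t c\<close> is
  linear and commutes with that action, so its image is an ideal for every \<open>t\<close>.\<close>

lemma lie_ideal_twisted_sum:
  assumes "lie_ideal scale bracket A" "lie_ideal scale bracket B" "lie_ideal scale bracket C"
  shows "lie_ideal scale bracket (twisted_sum A B C t)"
proof -
  have sub: "subspace A" "subspace B" "subspace C"
    and abs: "\<And>x y. y \<in> A \<Longrightarrow> bracket x y \<in> A" "\<And>x y. y \<in> B \<Longrightarrow> bracket x y \<in> B"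
      "\<And>x y. y \<in> C \<Longrightarrow> bracket x y \<in> C"
    using assms by (auto simp: lie_ideal_iff)
  have I: "b + scale t c \<in> twisted_sum A B C t" if "b \<in> B" "c \<in> C" "b + c \<in> A" for b c
    using that by (auto simp: twisted_sum_def)
  have "0 \<in> twisted_sum A B C t"
    using I[of 0 0] sub by (simp add: subspace_0)
  moreover have "u + v \<in> twisted_sum A B C t"
    if uv: "u \<in> twisted_sum A B C t" "v \<in> twisted_sum A B C t" for u v
  proof -
    obtain b c where u: "u = b + scale t c" "b \<in> B" "c \<in> C" "b + c \<in> A"
      using uv by (auto simp: twisted_sum_def)
    obtain b' c' where v: "v = b' + scale t c'" "b' \<in> B" "c' \<in> C" "b' + c' \<in> A"
      using uv by (auto simp: twisted_sum_def)
    have "(b + b') + (c + c') \<in> A"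
      using subspace_add[OF sub(1) u(4) v(4)] by (simp add: algebra_simps)
    with I[of "b + b'" "c + c'"] show ?thesis
      using u v sub by (simp add: subspace_add scale_right_distrib algebra_simps)
  qed
  moreover have "scale r u \<in> twisted_sum A B C t" if u_in: "u \<in> twisted_sum A B C t" for r u
  proof -
    obtain b c where u: "u = b + scale t c" "b \<in> B" "c \<in> C" "b + c \<in> A"
      using u_in by (auto simp: twisted_sum_def)
    have "scale r b + scale r c \<in> A"
      using subspace_scale[OF sub(1) u(4)] by (simp add: scale_right_distrib)
    with I[of "scale r b" "scale r c"] show ?thesis
      using u sub by (simp add: subspace_scale scale_right_distrib mult.commute)
  qed
  moreover have "bracket x u \<in> twisted_sum A B C t" if u_in: "u \<in> twisted_sum A B C t" for x u
  proof -
    obtain b c where u: "u = b + scale t c" "b \<in> B" "c \<in> C" "b + c \<in> A"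
      using u_in by (auto simp: twisted_sum_def)
    have "bracket x b + bracket x c \<in> A"
      using abs(1)[OF u(4)] by (simp add: bracket_add_right)
    with I[of "bracket x b" "bracket x c"] show ?thesis
      using u abs by (simp add: bracket_add_right bracket_scale_right)
  qed
  ultimately show ?thesis
    by (auto simp: lie_ideal_iff intro: subspaceI)
qed

lemma twisted_sum_eq_imp_distrib:
  assumes "subspace A" "subspace B" "subspace C"
    and eq: "twisted_sum A B C t = twisted_sum A B C s" and "t \<noteq> s"
  shows "A \<inter> (B + C) \<subseteq> A \<inter> B + A \<inter> C"
proof
  fix x assume "x \<in> A \<inter> (B + C)"
  then obtain b c where x: "x = b + c" "b \<in> B" "c \<in> C" "b + c \<in> A"
    by (auto elim: set_plus_elim)
  then have "b + scale t c \<in> twisted_sum A B C t"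
    by (auto simp: twisted_sum_def)
  then have "b + scale t c \<in> twisted_sum A B C s"
    using eq by simp
  then obtain b' c' where b'c': "b + scale t c = b' + scale s c'" "b' \<in> B" "c' \<in> C" "b' + c' \<in> A"
    by (auto simp: twisted_sum_def)
  define u where "u = b - b'"
  define v where "v = c - c'"
  \<comment> \<open>By definition \<open>u\<close> is a difference of elements of \<open>B\<close>;
    this second expression places it in \<open>C\<close> as well.\<close>
  have u_eq: "u = scale s c' - scale t c"
    using b'c'(1) by (simp add: u_def algebra_simps)
  have "u \<in> B"
    using assms x b'c' by (simp add: u_def subspace_diff)
  have "u \<in> C" "v \<in> C"
    using assms x b'c' by (simp_all add: u_eq v_def subspace_diff subspace_scale)
  have "u + v = (b + c) - (b' + c')"
    by (simp add: u_def v_def)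
  then have "u + v \<in> A"
    using assms x b'c' by (simp add: subspace_diff)
  \<comment> \<open>Eliminating \<open>c'\<close> gives \<open>u + scale s v\<close> on the right.
    It is regrouped around \<open>u + v\<close>, which lies in \<open>A \<inter> C\<close>, leaving
    a multiple of \<open>u\<close>, which lies in \<open>B \<inter> C\<close>. Since
    \<open>s - t\<close> is invertible, \<open>c\<close> splits accordingly as
    \<open>p + q\<close>.\<close>
  have "scale (s - t) c = scale s (u + v) + scale (1 - s) u"
  proof -
    have "c' = c - v" by (simp add: v_def)
    then have "scale (s - t) c = u + scale s v"
      using u_eq by (simp add: scale_left_diff_distrib scale_right_diff_distrib)
    then show ?thesis
      by (simp add: scale_left_diff_distrib scale_right_distrib)
  qed
  then have "scale (inverse (s - t)) (scale (s - t) c) =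
      scale (inverse (s - t)) (scale s (u + v)) + scale (inverse (s - t)) (scale (1 - s) u)"
    by (simp only: scale_right_distrib)
  moreover define p where "p = scale (inverse (s - t)) (scale s (u + v))"
  moreover define q where "q = scale (inverse (s - t)) (scale (1 - s) u)"
  ultimately have c: "c = p + q"
    using \<open>t \<noteq> s\<close> by simp
  have p: "p \<in> A \<inter> C"
    using assms \<open>u + v \<in> A\<close> \<open>u \<in> C\<close> \<open>v \<in> C\<close> unfolding p_def
    by (simp add: subspace_scale subspace_add del: scale_scale)
  have "q \<in> B"
    using assms \<open>u \<in> B\<close> by (simp add: q_def subspace_scale)
  \<comment> \<open>Moving \<open>q\<close> from the \<open>C\<close>-component to the
    \<open>B\<close>-component keeps the first summand in \<open>B\<close>; as \<open>x - p\<close>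
    it also lies in \<open>A\<close>.\<close>
  have "b + q = (b + c) - p"
    by (simp add: c)
  then have "b + q \<in> A \<inter> B"
    using assms x p \<open>q \<in> B\<close> by (metis IntD1 IntI subspace_add subspace_diff)
  moreover have "x = (b + q) + p"
    by (simp add: x c algebra_simps)
  ultimately show "x \<in> A \<inter> B + A \<inter> C"
    using p by (simp add: set_plus_intro)
qed

text \<open>Pigeonhole: infinitely many parameters index finitely many ideals, so two distinct
  parameters give the same twisted sum.\<close>

lemma lie_ideal_distrib:
  assumes "infinite (UNIV :: 'f set)" "finite {I. lie_ideal scale bracket I}"
    and ideals: "lie_ideal scale bracket A" "lie_ideal scale bracket B" "lie_ideal scale bracket C"
  shows "A \<inter> (B + C) = A \<inter> B + A \<inter> C"
proof
  have "range (twisted_sum A B C) \<subseteq> {I. lie_ideal scale bracket I}"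
    using lie_ideal_twisted_sum[OF ideals] by auto
  then have "\<not> inj (twisted_sum A B C)"
    using assms by (metis finite_imageD finite_subset)
  then obtain t s where "twisted_sum A B C t = twisted_sum A B C s" "t \<noteq> s"
    by (auto simp: inj_def)
  then show "A \<inter> (B + C) \<subseteq> A \<inter> B + A \<inter> C"
    using ideals by (intro twisted_sum_eq_imp_distrib) (auto simp: lie_ideal_iff)
  \<comment> \<open>This inclusion is the distributive inequality valid in every lattice.\<close>
  show "A \<inter> B + A \<inter> C \<subseteq> A \<inter> (B + C)"
    using ideals by (auto simp: lie_ideal_iff subspace_add elim!: set_plus_elim intro: set_plus_intro)
qed

lemma distributive_ideal_lattice:
  assumes "infinite (UNIV :: 'f set)" "finite {I. lie_ideal scale bracket I}"
  shows "distributive_lattice (ideal_lattice scale bracket)"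
proof -
  interpret lattice "ideal_lattice scale bracket"
    by (rule lattice_ideal_lattice)
  show ?thesis
  proof
    fix A B C
    assume "A \<in> carrier (ideal_lattice scale bracket)" "B \<in> carrier (ideal_lattice scale bracket)"
      "C \<in> carrier (ideal_lattice scale bracket)"
    then have "lie_ideal scale bracket A" "lie_ideal scale bracket B" "lie_ideal scale bracket C"
      by (auto simp: ideal_lattice_def)
    then show "A \<sqinter>\<^bsub>ideal_lattice scale bracket\<^esub> (B \<squnion>\<^bsub>ideal_lattice scale bracket\<^esub> C) =
      (A \<sqinter>\<^bsub>ideal_lattice scale bracket\<^esub> B) \<squnion>\<^bsub>ideal_lattice scale bracket\<^esub>
      (A \<sqinter>\<^bsub>ideal_lattice scale bracket\<^esub> C)"
      using lie_ideal_distrib[OF assms]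
      by (simp add: join_ideal_lattice meet_ideal_lattice lie_ideal_sum lie_ideal_inter)
  qed
qed

end

section \<open>Join-irreducible elements of a finite lattice\<close>

text \<open>A bottom element counts as join-irreducible here.\<close>

definition (in lattice) join_irreducible :: "'a \<Rightarrow> bool" where
  "join_irreducible j \<longleftrightarrow> j \<in> carrier L \<and>
     (\<forall>x\<in>carrier L. \<forall>y\<in>carrier L. j = x \<squnion> y \<longrightarrow> j = x \<or> j = y)"

definition (in lattice) irreducibles_below :: "'a \<Rightarrow> 'a set" where
  "irreducibles_below x = {j. join_irreducible j \<and> j \<sqsubseteq> x}"

text \<open>A minimal element among those below \<open>x\<close> but not below \<open>y\<close> is
  join-irreducible: if it were the join of two elements other than itself, both would be strictly
  smaller, hence below \<open>y\<close>, and so would their join.\<close>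

lemma (in lattice) join_irreducible_separates:
  assumes "finite (carrier L)" "x \<in> carrier L" "y \<in> carrier L" "\<not> x \<sqsubseteq> y"
  obtains j where "join_irreducible j" "j \<sqsubseteq> x" "\<not> j \<sqsubseteq> y"
proof -
  let ?P = "\<lambda>j. j \<in> carrier L \<and> j \<sqsubseteq> x \<and> \<not> j \<sqsubseteq> y"
  \<comment> \<open>The size of the principal down-set is a strictly monotone natural-number measure
    on a finite lattice, so an element of least size is minimal.\<close>
  let ?size = "\<lambda>j. card {z \<in> carrier L. z \<sqsubseteq> j}"
  have "?P x" using assms by simp
  then have "\<exists>j. ?P j \<and> (\<forall>k. ?P k \<longrightarrow> ?size j \<le> ?size k)"
    by (rule ex_has_least_nat)
  then obtain j where j: "?P j" and min: "\<forall>k. ?P k \<longrightarrow> ?size j \<le> ?size k"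
    by (elim exE conjE[of "?P _"])
  have below: "k \<sqsubseteq> y" if k: "k \<in> carrier L" "k \<sqsubseteq> j" "k \<noteq> j" for k
  proof (rule ccontr)
    assume "\<not> k \<sqsubseteq> y"
    moreover have "k \<sqsubseteq> x"
      using k j assms le_trans[of k j x] by simp
    ultimately have size: "?size j \<le> ?size k"
      using k min by simp
    moreover have "\<not> j \<sqsubseteq> k"
      using k j le_antisym[of k j] by auto
    moreover have "{z \<in> carrier L. z \<sqsubseteq> k} \<subseteq> {z \<in> carrier L. z \<sqsubseteq> j}"
      using k j le_trans[of _ k j] by auto
    moreover have "j \<in> {z \<in> carrier L. z \<sqsubseteq> j}"
      using j by simp
    ultimately have "{z \<in> carrier L. z \<sqsubseteq> k} \<subset> {z \<in> carrier L. z \<sqsubseteq> j}"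
      by blast
    then have "?size k < ?size j"
      using assms(1) by (intro psubset_card_mono) simp_all
    with size show False by simp
  qed
  have "join_irreducible j"
    unfolding join_irreducible_def
  proof (intro conjI ballI impI)
    fix a b assume ab: "a \<in> carrier L" "b \<in> carrier L" "j = a \<squnion> b"
    show "j = a \<or> j = b"
    proof (rule ccontr)
      assume "\<not> (j = a \<or> j = b)"
      then have "a \<sqsubseteq> y" "b \<sqsubseteq> y"
        using below[of a] below[of b] ab join_left[of a b] join_right[of a b] by auto
      then have "a \<squnion> b \<sqsubseteq> y"
        using ab assms by (intro join_le) auto
      then show False using ab j by simp
    qed
  qed (use j in simp)
  with j show ?thesis using that[of j] by simp
qed

lemma (in lattice) irreducibles_below_meet:
  assumes "x \<in> carrier L" "y \<in> carrier L"
  shows "irreducibles_below (x \<sqinter> y) = irreducibles_below x \<inter> irreducibles_below y"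
proof -
  have "j \<sqsubseteq> x \<sqinter> y \<longleftrightarrow> j \<sqsubseteq> x \<and> j \<sqsubseteq> y" if "j \<in> carrier L" for j
    using that assms meet_left[of x y] meet_right[of x y] meet_closed[of x y]
    by (blast intro: le_trans meet_le)
  then show ?thesis
    by (auto simp: irreducibles_below_def join_irreducible_def)
qed

text \<open>Distributivity makes a join-irreducible \<open>j\<close> join-prime: if \<open>j\<close>
  is below \<open>x \<squnion> y\<close>, then \<open>j\<close> is the join of
  \<open>j \<sqinter> x\<close> and \<open>j \<sqinter> y\<close>, so it equals one of them.\<close>

lemma (in distributive_lattice) irreducibles_below_join:
  assumes "x \<in> carrier L" "y \<in> carrier L"
  shows "irreducibles_below (x \<squnion> y) = irreducibles_below x \<union> irreducibles_below y"
proof -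
  have "j \<sqsubseteq> x \<squnion> y \<longleftrightarrow> j \<sqsubseteq> x \<or> j \<sqsubseteq> y" if irr: "join_irreducible j" for j
  proof
    have j: "j \<in> carrier L" using irr by (simp add: join_irreducible_def)
    assume "j \<sqsubseteq> x \<squnion> y"
    then have "j = j \<sqinter> (x \<squnion> y)"
      using j assms by (intro le_antisym meet_le) (auto simp: meet_left)
    also have "\<dots> = (j \<sqinter> x) \<squnion> (j \<sqinter> y)"
      using j assms by (rule meet_join_distrib)
    finally have "j = j \<sqinter> x \<or> j = j \<sqinter> y"
      using irr j assms unfolding join_irreducible_def by (meson meet_closed)
    then show "j \<sqsubseteq> x \<or> j \<sqsubseteq> y"
      using meet_right[of j x] meet_right[of j y] j assms by auto
  next
    have j: "j \<in> carrier L" using irr by (simp add: join_irreducible_def)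
    assume "j \<sqsubseteq> x \<or> j \<sqsubseteq> y"
    then show "j \<sqsubseteq> x \<squnion> y"
      using j assms join_left[of x y] join_right[of x y] join_closed[of x y]
      by (blast intro: le_trans)
  qed
  then show ?thesis
    by (auto simp: irreducibles_below_def)
qed

text \<open>Equal sets of irreducibles leave nothing to separate the two elements in either
  direction, so each is below the other.\<close>

lemma (in lattice) inj_on_irreducibles_below:
  assumes "finite (carrier L)"
  shows "inj_on irreducibles_below (carrier L)"
proof (rule inj_onI)
  fix x y assume xy: "x \<in> carrier L" "y \<in> carrier L" "irreducibles_below x = irreducibles_below y"
  have le: "a \<sqsubseteq> b" if ab: "a \<in> carrier L" "b \<in> carrier L"
      "irreducibles_below a = irreducibles_below b" for a b
  proof (rule ccontr)
    assume "\<not> a \<sqsubseteq> b"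
    with assms ab(1,2) obtain j where "join_irreducible j" "j \<sqsubseteq> a" "\<not> j \<sqsubseteq> b"
      by (rule join_irreducible_separates)
    then have "j \<in> irreducibles_below a" "j \<notin> irreducibles_below b"
      by (simp_all add: irreducibles_below_def)
    with ab(3) show False by simp
  qed
  show "x = y"
    using le[OF xy] le[OF xy(2,1) xy(3)[symmetric]] xy(1,2) by (rule le_antisym)
qed

section \<open>Embedding into a cube\<close>

text \<open>Restricting the carrier changes the sets of bounds from which join and meet are chosen.
  Closure of \<open>S\<close> under union and intersection ensures that these still are the least
  upper and greatest lower bounds within \<open>S\<close>.\<close>

lemma join_meet_sublattice_cube:
  assumes "sublattice S (cube_lattice n)" "A \<in> S" "B \<in> S"
  shows "A \<squnion>\<^bsub>cube_lattice n\<lparr>carrier := S\<rparr>\<^esub> B = A \<union> B"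
    and "A \<sqinter>\<^bsub>cube_lattice n\<lparr>carrier := S\<rparr>\<^esub> B = A \<inter> B"
proof -
  have eq: "cube_lattice n\<lparr>carrier := S\<rparr> = \<lparr>carrier = S, eq = (=), le = (\<subseteq>)\<rparr>"
    by (simp add: cube_lattice_def)
  have sub: "X \<subseteq> {1..n}" if "X \<in> S" for X
    using that assms(1) unfolding sublattice_def cube_lattice_def by auto
  have closed: "X \<union> Y \<in> S" "X \<inter> Y \<in> S" if "X \<in> S" "Y \<in> S" for X Y
    using assms(1) that join_cube_lattice[OF sub sub, OF that]
      meet_cube_lattice[OF sub sub, OF that]
    unfolding sublattice_def by metis+
  let ?L = "\<lparr>carrier = S, eq = (=), le = (\<subseteq>)\<rparr>"
  have j: "least ?L (X \<union> Y) (Upper ?L {X, Y})" and m: "greatest ?L (X \<inter> Y) (Lower ?L {X, Y})"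
    if "X \<in> S" "Y \<in> S" for X Y
    using that closed[OF that] by (simp_all add: least_def Upper_def greatest_def Lower_def)
  note * = inclusion_lattice[of S "(\<union>)" "(\<inter>)", OF j m]
  show "A \<squnion>\<^bsub>cube_lattice n\<lparr>carrier := S\<rparr>\<^esub> B = A \<union> B"
    unfolding eq using *(2) assms by blast
  show "A \<sqinter>\<^bsub>cube_lattice n\<lparr>carrier := S\<rparr>\<^esub> B = A \<inter> B"
    unfolding eq using *(3) assms by blast
qed

theorem finite_distributive_lattice_embeds_in_cube:
  fixes L :: "'a gorder" (structure)
  assumes "distributive_lattice L" and fin: "finite (carrier L)" and "carrier L \<noteq> {}"
  shows "\<exists>n S. sublattice S (cube_lattice n) \<and>
    lattice_isomorphic L (cube_lattice n\<lparr>carrier := S\<rparr>)"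
proof -
  interpret distributive_lattice L by fact
  have "finite {j. join_irreducible j}"
    by (rule finite_subset[OF _ fin]) (auto simp: join_irreducible_def)
  \<comment> \<open>Here \<open>n\<close> is the number of join-irreducibles, the bottom element
    included; \<open>e\<close> numbers them so that their subsets become vertices of the
    cube.\<close>
  then obtain e n where e: "bij_betw e {j. join_irreducible j} {1..n::nat}"
    using bij_betw_inv[OF someI_ex[OF ex_bij_betw_nat_finite_1]] by blast
  define h where "h x = e ` irreducibles_below x" for x
  have sub: "irreducibles_below x \<subseteq> {j. join_irreducible j}" for x
    by (auto simp: irreducibles_below_def)
  have cube: "h x \<subseteq> {1..n}" for x
    using sub[of x] e unfolding h_def bij_betw_def by blast
  have inj_e: "inj_on e {j. join_irreducible j}"
    using e by (rule bij_betw_imp_inj_on)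
  \<comment> \<open>Images always commute with unions; for intersections the injectivity of
    \<open>e\<close> is used.\<close>
  have join: "h (x \<squnion> y) = h x \<union> h y" and meet: "h (x \<sqinter> y) = h x \<inter> h y"
    if "x \<in> carrier L" "y \<in> carrier L" for x y
    using that inj_on_image_Int[OF inj_e sub sub]
    by (auto simp: h_def irreducibles_below_join irreducibles_below_meet image_Un)
  have inj_h: "inj_on h (carrier L)"
    using inj_on_irreducibles_below[OF fin] inj_on_image_eq_iff[OF inj_e sub sub]
    by (auto simp: inj_on_def h_def)
  let ?S = "h ` carrier L"
  have S: "sublattice ?S (cube_lattice n)"
    unfolding sublattice_def
  proof (intro conjI ballI)
    show "?S \<subseteq> carrier (cube_lattice n)"
      using cube by (auto simp: cube_lattice_def)
    fix A B assume "A \<in> ?S" "B \<in> ?S"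
    then obtain x y where "x \<in> carrier L" "y \<in> carrier L" "A = h x" "B = h y" by auto
    then show "A \<squnion>\<^bsub>cube_lattice n\<^esub> B \<in> ?S" "A \<sqinter>\<^bsub>cube_lattice n\<^esub> B \<in> ?S"
      using cube by (simp_all add: join_cube_lattice meet_cube_lattice flip: join meet)
  qed (use assms in simp)
  moreover have "lattice_isomorphic L (cube_lattice n\<lparr>carrier := ?S\<rparr>)"
    unfolding lattice_isomorphic_def
    using inj_h by (intro exI[of _ h])
      (simp add: bij_betw_def join meet join_meet_sublattice_cube[OF S])
  ultimately show ?thesis by blast
qed

theorem theorem2p4:
  fixes scale :: "'f::field_char_0 \<Rightarrow> 'a::ab_group_add \<Rightarrow> 'a"
    and bracket :: "'a \<Rightarrow> 'a \<Rightarrow> 'a"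
    and Basis :: "'a set"
  assumes "lie_algebra scale bracket"
    and "finite_dimensional_vector_space scale Basis"
    and "finite (carrier (ideal_lattice scale bracket))"
  shows "distributive_lattice (ideal_lattice scale bracket) \<and>
    (\<exists>n S. sublattice S (cube_lattice n) \<and>
       lattice_isomorphic (ideal_lattice scale bracket) (cube_lattice n\<lparr>carrier := S\<rparr>))"
proof -
  interpret lie_algebra scale bracket by fact
  \<comment> \<open>Characteristic zero supplies the infinite ground field.\<close>
  have dist: "distributive_lattice (ideal_lattice scale bracket)"
    using assms(3) by (intro distributive_ideal_lattice infinite_UNIV_char_0)
      (simp add: ideal_lattice_def)
  \<comment> \<open>The whole algebra is an ideal, which witnesses the nonemptiness built into
    \<open>sublattice\<close>.\<close>
  have "lie_ideal scale bracket UNIV"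
    by (simp add: lie_ideal_iff subspace_UNIV)
  then have "carrier (ideal_lattice scale bracket) \<noteq> {}"
    by (auto simp: ideal_lattice_def)
  with dist assms(3) show ?thesis
    by (intro conjI finite_distributive_lattice_embeds_in_cube)
qed

end
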